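(* Let $k\ge 1$, let $\mathcal{G}_1,\ldots,\mathcal{G}_k$ be ordered graphs, each containing at least one edge, let $\boldsymbol{\lambda}=(\lambda_1,\ldots,\lambda_k)\in(0,\infty)^k$, and put $h_i=v(\mathcal{G}_i)$, $e_i=e(\mathcal{G}_i)$, $h_*=\min_{i\in[k]}h_i$ and $I_*=\{i\in[k]:h_i=h_*\}$. For every $n$, $$\overline{\mathrm{M}}_{\boldsymbol{\lambda}}(n;\mathcal{G}_1,\ldots,\mathcal{G}_k)\ \le\ \min_{\substack{p_1,\ldots,p_k\ge0\\ \sum_{i=1}^k p_i=1}}\ \sum_{i=1}^{k}\lambda_i p_i^{e_i}\binom{n}{h_i}.$$ Thus $$\pi_{\boldsymbol{\lambda}}(\mathcal{G}_1,\ldots,\mathcal{G}_k)\ \le\ \min_{\substack{p_i\ge0\ (i\in I_* )\\ \sum_{i\in I_*}p_i=1}}\ \sum_{i\in I_*}\lambda_i p_i^{e_i}.\qquad(\ast)$$ In particular, if there is $e>1$ with $e_i=e$ for every $i\in I_*$, then $$\pi_{\boldsymbol{\lambda}}(\mathcal{G}_1,\ldots,\mathcal{G}_k)\ \le\ \left(\sum_{i\in I_*}\lambda_i^{-1/(e-1)}\right)^{1-e},$$ and if $e_i=1$ for every $i\in I_*$, then the right-hand side of $(\ast)$ equals $\min_{i\in I_*}\lambda_i$.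
   Context: An ordered graph is a pair $\mathcal{G}=(G,<_{\mathcal{G}})$ where $G$ is a finite graph and $<_{\mathcal{G}}$ is a linear order on $V(G)$; $v(\mathcal{G})$ and $e(\mathcal{G})$ are its numbers of vertices and edges. $[k]=\{1,\ldots,k\}$. $\mathcal{K}_n$ is the complete graph on $[n]$ with the natural order. An order-preserving copy of an ordered graph $\mathcal{H}$ in $\mathcal{G}$ is an injective map $V(\mathcal{H})\to V(\mathcal{G})$ that preserves the vertex order and maps every edge of $\mathcal{H}$ to an edge of $\mathcal{G}$; copies are counted by their vertex sets (an $h$-element vertex set supports at most one copy of a fixed $h$-vertex ordered graph). For a coloring $\chi:E(\mathcal{K}_n)\to[k]$, $N_i(\chi;\mathcal{G}_i)$ is the number of order-preserving copies of $\mathcal{G}_i$ in $\mathcal{K}_n$ all of whose edges have color $i$. The weighted ordered multiplicity function is $$\overline{\mathrm{M}}_{\boldsymbol{\lambda}}(n;\mathcal{G}_1,\ldots,\mathcal{G}_k)=\min_{\chi:E(\mathcal{K}_n)\to[k]}\sum_{i=1}^{k}\lambda_iN_i(\chi;\mathcal{G}_i),$$ and $$\pi_{\boldsymbol{\lambda}}(\mathcal{G}_1,\ldots,\mathcal{G}_k)=\lim_{n\to\infty}\frac{\overline{\mathrm{M}}_{\boldsymbol{\lambda}}(n;\mathcal{G}_1,\ldots,\mathcal{G}_k)}{\binom{n}{h_*}},$$ a limit which exists. Convention: $\binom{x}{q}=0$ when $q<0$ or $q>x$. *)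

theory Defs
  imports "HOL-Analysis.Analysis"
begin

section \<open>Ordered graphs\<close>

record 'a ograph =
  verts :: "'a set"
  edges :: "'a set set"
  lt :: "'a rel"

text \<open>Graphs are finite, simple and undirected; the order is the strict one.\<close>

definition ordered_graph :: "'a ograph \<Rightarrow> bool" where
  "ordered_graph G \<longleftrightarrow>
     finite (verts G) \<and>
     (\<forall>e \<in> edges G. e \<subseteq> verts G \<and> card e = 2) \<and>
     lt G \<subseteq> verts G \<times> verts G \<and>
     strict_linear_order_on (verts G) (lt G)"

definition num_verts :: "'a ograph \<Rightarrow> nat" where
  "num_verts G = card (verts G)"

definition num_edges :: "'a ograph \<Rightarrow> nat" where
  "num_edges G = card (edges G)"

definition complete_ograph :: "nat \<Rightarrow> nat ograph" where
  "complete_ograph n =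
     \<lparr> verts = {1..n},
       edges = {e. e \<subseteq> {1..n} \<and> card e = 2},
       lt = {(x, y). x \<in> {1..n} \<and> y \<in> {1..n} \<and> x < y} \<rparr>"

definition op_copy :: "'a ograph \<Rightarrow> 'b ograph \<Rightarrow> ('a \<Rightarrow> 'b) \<Rightarrow> bool" where
  "op_copy H G f \<longleftrightarrow>
     f \<in> verts H \<rightarrow> verts G \<and>
     inj_on f (verts H) \<and>
     (\<forall>(x, y) \<in> lt H. (f x, f y) \<in> lt G) \<and>
     (\<forall>e \<in> edges H. f ` e \<in> edges G)"


section \<open>Weighted multiplicities\<close>

definition colorings :: "nat \<Rightarrow> nat \<Rightarrow> (nat set \<Rightarrow> nat) set" where
  "colorings k n = edges (complete_ograph n) \<rightarrow>\<^sub>E {1..k}"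

text \<open>Copies are counted by their vertex sets. The edges of the copy given by \<open>f\<close> are the
  images under \<open>f\<close> of the edges of \<open>H\<close>, so a copy need not be induced.\<close>

definition num_mono :: "nat \<Rightarrow> (nat set \<Rightarrow> nat) \<Rightarrow> nat \<Rightarrow> 'a ograph \<Rightarrow> nat" where
  "num_mono n \<phi> c H =
     card {f ` verts H | f. op_copy H (complete_ograph n) f \<and> (\<forall>e \<in> edges H. \<phi> (f ` e) = c)}"

definition multiplicity_fun :: "nat \<Rightarrow> (nat \<Rightarrow> real) \<Rightarrow> nat \<Rightarrow> (nat \<Rightarrow> 'a ograph) \<Rightarrow> real" where
  "multiplicity_fun k lam n G =
     Min ((\<lambda>\<phi>. \<Sum>i\<in>{1..k}. lam i * real (num_mono n \<phi> i (G i))) ` colorings k n)"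

definition min_order :: "nat \<Rightarrow> (nat \<Rightarrow> 'a ograph) \<Rightarrow> nat" where
  "min_order k G = Min ((\<lambda>i. num_verts (G i)) ` {1..k})"

definition min_order_indices :: "nat \<Rightarrow> (nat \<Rightarrow> 'a ograph) \<Rightarrow> nat set" where
  "min_order_indices k G = {i \<in> {1..k}. num_verts (G i) = min_order k G}"

definition multiplicity_const :: "nat \<Rightarrow> (nat \<Rightarrow> real) \<Rightarrow> (nat \<Rightarrow> 'a ograph) \<Rightarrow> real" where
  "multiplicity_const k lam G =
     lim (\<lambda>n. multiplicity_fun k lam n G / real (n choose min_order k G))"


section \<open>Minima over the probability simplex\<close>

definition simplex_on :: "'i set \<Rightarrow> ('i \<Rightarrow> real) set" where
  "simplex_on I = {p. (\<forall>i \<in> I. 0 \<le> p i) \<and> sum p I = 1}"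

definition minimum_on :: "'b set \<Rightarrow> ('b \<Rightarrow> real) \<Rightarrow> real" where
  "minimum_on S f = (LEAST y. y \<in> f ` S)"


section \<open>Well-definedness of the limit and of the minima\<close>

text \<open>Without these facts \<^const>\<open>lim\<close> and \<^const>\<open>Least\<close> would denote unspecified values.\<close>

lemma minimum_on_simplex:
  fixes I :: "'i set" and c :: "'i \<Rightarrow> real" and d :: "'i \<Rightarrow> nat"
  assumes fin: "finite I" and ne: "I \<noteq> {}"
  defines "F \<equiv> \<lambda>p. \<Sum>i\<in>I. c i * p i ^ d i"
  shows "\<exists>p \<in> simplex_on I. minimum_on (simplex_on I) F = F p \<and> (\<forall>q \<in> simplex_on I. F p \<le> F q)"
proof -
  define B where "B = (\<Pi>\<^sub>E i\<in>(UNIV::'i set). if i \<in> I then {0..1::real} else {0})"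
  define K where "K = B \<inter> {p. sum p I = 1}"
  have "compactin (product_topology (\<lambda>i. euclidean) (UNIV::'i set)) B"
    unfolding B_def by (subst compactin_PiE) (auto simp: compactin_euclidean_iff)
  then have "compact B"
    by (simp add: euclidean_product_topology compactin_euclidean_iff)
  moreover have "closed {p :: 'i \<Rightarrow> real. sum p I = 1}"
    by (intro closed_Collect_eq continuous_intros continuous_on_product_coordinates)
  ultimately have "compact K"
    unfolding K_def by (rule compact_Int_closed)
  moreover have "continuous_on K F"
    unfolding F_def
    by (intro continuous_intros continuous_on_subset[OF continuous_on_product_coordinates]) auto
  moreover obtain i0 where i0: "i0 \<in> I"
    using ne by blast
  have "(\<lambda>i. if i = i0 then 1 else 0) \<in> K"
    using i0 fin by (auto simp: K_def B_def)
  then have "K \<noteq> {}"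
    by blast
  ultimately obtain p where p: "p \<in> K" "\<And>q. q \<in> K \<Longrightarrow> F p \<le> F q"
    using continuous_attains_inf[of K F] by blast
  have pS: "p \<in> simplex_on I"
    using p(1) by (force simp: K_def B_def simplex_on_def PiE_def Pi_def split: if_splits)
  have le: "F p \<le> F q" if q: "q \<in> simplex_on I" for q
  proof -
    define q' where "q' = (\<lambda>i. if i \<in> I then q i else 0)"
    have "q i \<le> 1" if "i \<in> I" for i
      using member_le_sum[of i I q] that q fin by (auto simp: simplex_on_def)
    then have "q' \<in> K"
      using q by (auto simp: K_def B_def q'_def simplex_on_def cong: sum.cong)
    moreover have "F q' = F q"
      unfolding F_def q'_def by (intro sum.cong) auto
    ultimately show ?thesis
      using p(2) by metis
  qed
  have "minimum_on (simplex_on I) F = F p"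
    unfolding minimum_on_def by (rule Least_equality) (use pS le in auto)
  with pS le show ?thesis
    by blast
qed

lemma op_copy_image:
  assumes "op_copy H (complete_ograph n) f"
  shows "f ` verts H \<subseteq> {1..n}" "card (f ` verts H) = num_verts H"
  using assms by (auto simp: op_copy_def complete_ograph_def num_verts_def card_image)

definition mono_copies :: "nat \<Rightarrow> (nat set \<Rightarrow> nat) \<Rightarrow> nat \<Rightarrow> 'a ograph \<Rightarrow> nat set set" where
  "mono_copies n \<phi> c H =
     {f ` verts H | f. op_copy H (complete_ograph n) f \<and> (\<forall>e \<in> edges H. \<phi> (f ` e) = c)}"

lemma num_mono_eq: "num_mono n \<phi> c H = card (mono_copies n \<phi> c H)"
  by (simp add: num_mono_def mono_copies_def)

lemma mono_copies_sub: "mono_copies n \<phi> c H \<subseteq> {S. S \<subseteq> {1..n} \<and> card S = num_verts H}"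
  unfolding mono_copies_def using op_copy_image by fastforce

lemma finite_mono_copies: "finite (mono_copies n \<phi> c H)"
  by (rule finite_subset[OF mono_copies_sub]) simp

lemma num_mono_le: "num_mono n \<phi> c H \<le> n choose num_verts H"
  unfolding num_mono_eq
  using card_mono[OF _ mono_copies_sub[of n \<phi> c H]] n_subsets[of "{1..n}" "num_verts H"] by simp

lemma finite_colorings: "finite (colorings k n)"
proof -
  have "finite (edges (complete_ograph n))"
    by (rule finite_subset[of _ "Pow {1..n}"]) (auto simp: complete_ograph_def)
  then show ?thesis
    unfolding colorings_def by (intro finite_PiE) auto
qed

lemma colorings_nonempty: "k \<ge> 1 \<Longrightarrow> colorings k n \<noteq> {}"
  unfolding colorings_def by (auto simp: PiE_eq_empty_iff)

lemma multiplicity_fun_le: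
  assumes "\<phi> \<in> colorings k n"
  shows "multiplicity_fun k lam n G \<le> (\<Sum>i\<in>{1..k}. lam i * real (num_mono n \<phi> i (G i)))"
  unfolding multiplicity_fun_def using assms finite_colorings by (intro Min_le) auto

lemma multiplicity_fun_attained:
  assumes "k \<ge> 1"
  obtains \<phi> where "\<phi> \<in> colorings k n"
    "multiplicity_fun k lam n G = (\<Sum>i\<in>{1..k}. lam i * real (num_mono n \<phi> i (G i)))"
  using Min_in[of "(\<lambda>\<phi>. \<Sum>i\<in>{1..k}. lam i * real (num_mono n \<phi> i (G i))) ` colorings k n"]
    finite_colorings colorings_nonempty[OF assms] unfolding multiplicity_fun_def by blast

text \<open>\<open>skip v\<close> is the increasing bijection from \<open>{1..n}\<close> onto \<open>{1..Suc n} - {v}\<close>; pulling a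
  coloring back along it deletes the vertex \<open>v\<close>.\<close>

definition skip :: "nat \<Rightarrow> nat \<Rightarrow> nat" where
  "skip v x = (if x < v then x else Suc x)"

lemma inj_skip: "inj_on (skip v) A"
  by (auto simp: inj_on_def skip_def split: if_splits)

definition delete_vertex :: "nat \<Rightarrow> nat \<Rightarrow> (nat set \<Rightarrow> nat) \<Rightarrow> nat set \<Rightarrow> nat" where
  "delete_vertex n v \<phi> = (\<lambda>e \<in> edges (complete_ograph n). \<phi> (skip v ` e))"

lemma skip_edge:
  assumes "e \<in> edges (complete_ograph n)"
  shows "skip v ` e \<in> edges (complete_ograph (Suc n))"
  using assms card_image[OF inj_skip[of v e]]
  by (auto simp: complete_ograph_def skip_def subset_iff)

lemma delete_vertex_colorings:
  "\<phi> \<in> colorings k (Suc n) \<Longrightarrow> delete_vertex n v \<phi> \<in> colorings k n"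
  using skip_edge by (fastforce simp: colorings_def delete_vertex_def PiE_def Pi_def)

lemma num_mono_delete_vertex:
  "num_mono n (delete_vertex n v \<phi>) c H \<le> card {S \<in> mono_copies (Suc n) \<phi> c H. v \<notin> S}"
  unfolding num_mono_eq
proof (rule card_inj_on_le)
  show "inj_on ((`) (skip v)) (mono_copies n (delete_vertex n v \<phi>) c H)"
    using inj_skip[of v UNIV] by (auto simp: inj_on_def inj_image_eq_iff)
  show "finite {S \<in> mono_copies (Suc n) \<phi> c H. v \<notin> S}"
    by (rule finite_subset[OF _ finite_mono_copies[of "Suc n" \<phi> c H]]) blast
  show "(`) (skip v) ` mono_copies n (delete_vertex n v \<phi>) c H
      \<subseteq> {S \<in> mono_copies (Suc n) \<phi> c H. v \<notin> S}"
  proof (rule image_subsetI)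
    fix S assume "S \<in> mono_copies n (delete_vertex n v \<phi>) c H"
    then obtain f where f: "S = f ` verts H" "op_copy H (complete_ograph n) f"
      "\<forall>e\<in>edges H. delete_vertex n v \<phi> (f ` e) = c"
      by (auto simp: mono_copies_def)
    have E: "f ` e \<in> edges (complete_ograph n)" if "e \<in> edges H" for e
      using f(2) that by (auto simp: op_copy_def)
    have verts: "(skip v \<circ> f) \<in> verts H \<rightarrow> {1..Suc n}"
      using f(2) by (fastforce simp: op_copy_def complete_ograph_def skip_def Pi_def)
    have lt: "\<forall>(x, y) \<in> lt H. ((skip v \<circ> f) x, (skip v \<circ> f) y) \<in> lt (complete_ograph (Suc n))"
      using f(2) by (fastforce simp: op_copy_def complete_ograph_def skip_def)
    have "op_copy H (complete_ograph (Suc n)) (skip v \<circ> f)"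
      unfolding op_copy_def
    proof (intro conjI)
      show "skip v \<circ> f \<in> verts H \<rightarrow> verts (complete_ograph (Suc n))"
        using verts by (simp add: complete_ograph_def)
      show "inj_on (skip v \<circ> f) (verts H)"
        using f(2) inj_skip by (auto simp: op_copy_def intro: comp_inj_on)
      show "\<forall>e\<in>edges H. (skip v \<circ> f) ` e \<in> edges (complete_ograph (Suc n))"
        using skip_edge E by (metis image_comp)
    qed (rule lt)
    moreover have "\<forall>e\<in>edges H. \<phi> ((skip v \<circ> f) ` e) = c"
      using f(3) E by (auto simp: delete_vertex_def image_comp)
    moreover have "skip v ` S = (skip v \<circ> f) ` verts H"
      using f(1) by (simp add: image_comp)
    ultimately have "skip v ` S \<in> mono_copies (Suc n) \<phi> c H"
      unfolding mono_copies_def by blast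
    moreover have "v \<notin> skip v ` S"
      by (auto simp: skip_def split: if_splits)
    ultimately show "skip v ` S \<in> {S \<in> mono_copies (Suc n) \<phi> c H. v \<notin> S}"
      by blast
  qed
qed

lemma sum_num_mono_delete_vertex:
  "(\<Sum>v\<in>{1..Suc n}. num_mono n (delete_vertex n v \<phi>) c H)
     \<le> (Suc n - num_verts H) * num_mono (Suc n) \<phi> c H"
proof -
  let ?C = "mono_copies (Suc n) \<phi> c H"
  have "(\<Sum>v\<in>{1..Suc n}. num_mono n (delete_vertex n v \<phi>) c H)
      \<le> (\<Sum>v\<in>{1..Suc n}. card {S \<in> ?C. v \<notin> S})"
    by (intro sum_mono num_mono_delete_vertex)
  also have "\<dots> = (\<Sum>S\<in>?C. card {v \<in> {1..Suc n}. v \<notin> S})"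
    using sum_multicount_gen[of "{1..Suc n}" ?C "\<lambda>v S. v \<notin> S"
        "\<lambda>S. card {v \<in> {1..Suc n}. v \<notin> S}"] finite_mono_copies[of "Suc n" \<phi> c H]
    by (simp del: sum.cl_ivl_Suc)
  also have "\<dots> = (\<Sum>S\<in>?C. Suc n - num_verts H)"
  proof (rule sum.cong[OF refl])
    fix S assume "S \<in> ?C"
    then have S: "S \<subseteq> {1..Suc n}" "card S = num_verts H"
      using mono_copies_sub by blast+
    have "{v \<in> {1..Suc n}. v \<notin> S} = {1..Suc n} - S"
      by blast
    then show "card {v \<in> {1..Suc n}. v \<notin> S} = Suc n - num_verts H"
      using S card_Diff_subset[of S "{1..Suc n}"] finite_subset[OF S(1)] by simp
  qed
  also have "\<dots> = (Suc n - num_verts H) * num_mono (Suc n) \<phi> c H"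
    by (simp add: num_mono_eq)
  finally show ?thesis .
qed

lemma multiplicity_fun_averaging:
  assumes k: "k \<ge> 1" and pos: "\<And>i. i \<in> {1..k} \<Longrightarrow> lam i > 0"
  shows "real (Suc n) * multiplicity_fun k lam n G
      \<le> real (Suc n - min_order k G) * multiplicity_fun k lam (Suc n) G"
proof -
  obtain \<phi> where \<phi>: "\<phi> \<in> colorings k (Suc n)"
    "multiplicity_fun k lam (Suc n) G = (\<Sum>i\<in>{1..k}. lam i * real (num_mono (Suc n) \<phi> i (G i)))"
    using multiplicity_fun_attained[OF k] .
  have "real (Suc n) * multiplicity_fun k lam n G = (\<Sum>v\<in>{1..Suc n}. multiplicity_fun k lam n G)"
    by simp
  also have "\<dots> \<le> (\<Sum>v\<in>{1..Suc n}. \<Sum>i\<in>{1..k}.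
      lam i * real (num_mono n (delete_vertex n v \<phi>) i (G i)))"
    by (intro sum_mono multiplicity_fun_le delete_vertex_colorings \<phi>)
  also have "\<dots> = (\<Sum>i\<in>{1..k}.
      lam i * real (\<Sum>v\<in>{1..Suc n}. num_mono n (delete_vertex n v \<phi>) i (G i)))"
    by (subst sum.swap) (simp only: sum_distrib_left of_nat_sum)
  also have "\<dots> \<le> (\<Sum>i\<in>{1..k}.
      lam i * real ((Suc n - min_order k G) * num_mono (Suc n) \<phi> i (G i)))"
  proof (intro sum_mono mult_left_mono)
    fix i assume i: "i \<in> {1..k}"
    have "min_order k G \<le> num_verts (G i)"
      unfolding min_order_def using i by (intro Min_le) auto
    then have "(Suc n - num_verts (G i)) * num_mono (Suc n) \<phi> i (G i)
        \<le> (Suc n - min_order k G) * num_mono (Suc n) \<phi> i (G i)"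
      by (intro mult_right_mono) auto
    then show "real (\<Sum>v\<in>{1..Suc n}. num_mono n (delete_vertex n v \<phi>) i (G i))
        \<le> real ((Suc n - min_order k G) * num_mono (Suc n) \<phi> i (G i))"
      using sum_num_mono_delete_vertex[of n \<phi> i "G i"] by linarith
    show "0 \<le> lam i"
      using pos[OF i] by simp
  qed
  also have "\<dots> = real (Suc n - min_order k G) * multiplicity_fun k lam (Suc n) G"
    by (simp add: \<phi>(2) sum_distrib_left mult_ac)
  finally show ?thesis .
qed

lemma multiplicity_fun_bounded:
  assumes k: "k \<ge> 1" and pos: "\<And>i. i \<in> {1..k} \<Longrightarrow> lam i > 0"
    and edge: "\<And>i. i \<in> {1..k} \<Longrightarrow> edges (G i) \<noteq> {}"
  obtains C where "\<And>n. multiplicity_fun k lam n G \<le> C * real (n choose min_order k G)"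
proof -
  have "min_order k G \<in> (\<lambda>i. num_verts (G i)) ` {1..k}"
    unfolding min_order_def using k by (intro Min_in) auto
  then obtain j where j: "j \<in> {1..k}" "num_verts (G j) = min_order k G"
    by auto
  have "multiplicity_fun k lam n G \<le> lam j * real (n choose min_order k G)" for n
  proof -
    define \<phi> where "\<phi> = (\<lambda>e \<in> edges (complete_ograph n). j)"
    have \<phi>: "\<phi> \<in> colorings k n"
      using j(1) by (auto simp: \<phi>_def colorings_def)
    have "num_mono n \<phi> i (G i) = 0" if i: "i \<in> {1..k}" "i \<noteq> j" for i
    proof -
      obtain e where e: "e \<in> edges (G i)"
        using edge[OF i(1)] by blast
      have "\<phi> (f ` e) = j" if "op_copy (G i) (complete_ograph n) f" for f
        using that e by (auto simp: \<phi>_def op_copy_def)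
      then have "mono_copies n \<phi> i (G i) = {}"
        using e i(2) by (fastforce simp: mono_copies_def)
      then show ?thesis
        by (simp add: num_mono_eq)
    qed
    then have "(\<Sum>i\<in>{1..k}. lam i * real (num_mono n \<phi> i (G i))) = lam j * real (num_mono n \<phi> j (G j))"
      using j(1) by (subst sum.remove[of _ j]) auto
    also have "\<dots> \<le> lam j * real (n choose min_order k G)"
      using num_mono_le[of n \<phi> j "G j"] j pos[OF j(1)] by (intro mult_left_mono) auto
    finally show ?thesis
      using multiplicity_fun_le[OF \<phi>, of lam G] by linarith
  qed
  then show thesis
    by (rule that)
qed

lemma multiplicity_const_tendsto:
  assumes k: "k \<ge> 1" and pos: "\<And>i. i \<in> {1..k} \<Longrightarrow> lam i > 0"
    and edge: "\<And>i. i \<in> {1..k} \<Longrightarrow> edges (G i) \<noteq> {}"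
  shows "(\<lambda>n. multiplicity_fun k lam n G / real (n choose min_order k G))
           \<longlonglongrightarrow> multiplicity_const k lam G"
proof -
  define h where "h = min_order k G"
  define a where "a = (\<lambda>n. multiplicity_fun k lam n G / real (n choose h))"
  obtain C where C: "\<And>n. multiplicity_fun k lam n G \<le> C * real (n choose h)"
    using multiplicity_fun_bounded[where lam = lam and G = G, OF k pos edge] unfolding h_def by blast
  have step: "a (n + h) \<le> a (Suc n + h)" for n
  proof -
    let ?m = "n + h"
    have p: "0 < real (?m choose h)" "0 < real (Suc ?m choose h)"
      by (simp_all add: zero_less_binomial)
    have "(Suc ?m - h) * (Suc ?m choose h) = Suc ?m * (?m choose h)"
      using binomial_absorb_comp[of "Suc ?m" h] by simp
    then have b: "real (Suc ?m - h) * real (Suc ?m choose h) = real (Suc ?m) * real (?m choose h)"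
      by (metis of_nat_mult)
    have "real (Suc ?m) * multiplicity_fun k lam ?m G
        \<le> real (Suc ?m - h) * multiplicity_fun k lam (Suc ?m) G"
      unfolding h_def by (rule multiplicity_fun_averaging[where lam = lam, OF k pos])
    then have "real (Suc ?m) * multiplicity_fun k lam ?m G * real (Suc ?m choose h)
        \<le> real (Suc ?m - h) * multiplicity_fun k lam (Suc ?m) G * real (Suc ?m choose h)"
      by (intro mult_right_mono) auto
    also have "\<dots> = multiplicity_fun k lam (Suc ?m) G * (real (Suc ?m) * real (?m choose h))"
      by (simp only: b[symmetric] mult_ac)
    finally have "real (Suc ?m) * (multiplicity_fun k lam ?m G * real (Suc ?m choose h))
        \<le> real (Suc ?m) * (multiplicity_fun k lam (Suc ?m) G * real (?m choose h))"
      by (simp only: mult_ac)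
    then have "multiplicity_fun k lam ?m G * real (Suc ?m choose h)
        \<le> multiplicity_fun k lam (Suc ?m) G * real (?m choose h)"
      by (subst (asm) mult_le_cancel_left_pos) auto
    then show ?thesis
      using p unfolding a_def by (simp add: frac_le_eq divide_simps)
  qed
  have "a (n + h) \<le> C" for n
    using C[of "n + h"] by (simp add: a_def divide_le_eq zero_less_binomial)
  moreover have "incseq (\<lambda>n. a (n + h))"
    using step by (intro incseq_SucI) simp
  ultimately obtain L where "(\<lambda>n. a (n + h)) \<longlonglongrightarrow> L"
    using incseq_convergent[of "\<lambda>n. a (n + h)" C] by blast
  then have "a \<longlonglongrightarrow> L"
    by (rule LIMSEQ_offset)
  then show ?thesis
    unfolding multiplicity_const_def a_def h_def using limI by blast
qed

end

theory Submission
  imports Defs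
begin

text \<open>Color the edges of the complete graph independently, giving color \<open>i\<close> with probability
  \<open>p i\<close>. A vertex set of size \<open>h\<^sub>i\<close> carries at most one possible copy of \<open>G i\<close>, which is
  monochromatic of color \<open>i\<close> with probability \<open>p i ^ e\<^sub>i\<close>, so some coloring does at least as well as the
  expectation. Extending \<open>p\<close> by \<open>0\<close> outside the indices of minimal order gives the bound on the
  limit; choosing \<open>p i\<close> proportional to \<open>\<lambda>\<^sub>i powr (-1/(e-1))\<close> gives the closed form.\<close>

section \<open>Minima of weighted power sums over the simplex\<close>

lemma minimum_on_simplex_le:
  fixes c :: "'i \<Rightarrow> real" and d :: "'i \<Rightarrow> nat"
  assumes "finite I" "p \<in> simplex_on I"
  shows "minimum_on (simplex_on I) (\<lambda>p. \<Sum>i\<in>I. c i * p i ^ d i) \<le> (\<Sum>i\<in>I. c i * p i ^ d i)"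
proof -
  have "I \<noteq> {}"
    using assms by (auto simp: simplex_on_def)
  from minimum_on_simplex[OF assms(1) this, of c d] show ?thesis
    using assms(2) by (elim bexE conjE) (erule ssubst, erule bspec)
qed

lemma minimum_on_simplex_greatest:
  fixes c :: "'i \<Rightarrow> real" and d :: "'i \<Rightarrow> nat"
  assumes "finite I" "I \<noteq> {}"
    and "\<And>p. p \<in> simplex_on I \<Longrightarrow> x \<le> (\<Sum>i\<in>I. c i * p i ^ d i)"
  shows "x \<le> minimum_on (simplex_on I) (\<lambda>p. \<Sum>i\<in>I. c i * p i ^ d i)"
  using minimum_on_simplex[OF assms(1,2), of c d]
  by (elim bexE conjE) (erule ssubst, erule assms(3))

text \<open>On the simplex the sum is an average of the \<open>c i\<close>, hence at least their
  minimum, and a point mass at a minimizing index attains it. The exponent \<open>1\<close> stays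
  visible to match the general shape \<open>c i * p i ^ d i\<close>.\<close>

lemma minimum_on_simplex_linear:
  fixes c :: "'i \<Rightarrow> real"
  assumes I: "finite I" "I \<noteq> {}"
  shows "minimum_on (simplex_on I) (\<lambda>p. \<Sum>i\<in>I. c i * p i ^ 1) = Min (c ` I)"
proof (rule antisym)
  obtain j where j: "j \<in> I" "c j = Min (c ` I)"
    using Min_in[of "c ` I"] I by fastforce
  define p where "p = (\<lambda>i. if i = j then 1 else 0 :: real)"
  have "p \<in> simplex_on I"
    using j(1) I by (auto simp: simplex_on_def p_def)
  moreover have "(\<Sum>i\<in>I. c i * p i ^ 1) = c j"
    using I j(1) by (simp add: p_def if_distrib[of "(*) _"] cong: if_cong)
  ultimately show "minimum_on (simplex_on I) (\<lambda>p. \<Sum>i\<in>I. c i * p i ^ 1) \<le> Min (c ` I)"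
    using minimum_on_simplex_le[OF I(1), of p c "\<lambda>_. 1"] j(2) by simp
next
  show "Min (c ` I) \<le> minimum_on (simplex_on I) (\<lambda>p. \<Sum>i\<in>I. c i * p i ^ 1)"
  proof (rule minimum_on_simplex_greatest[OF I])
    fix p assume p: "p \<in> simplex_on I"
    have "Min (c ` I) = (\<Sum>i\<in>I. Min (c ` I) * p i)"
      using p by (simp add: simplex_on_def flip: sum_distrib_left)
    also have "\<dots> \<le> (\<Sum>i\<in>I. c i * p i)"
      using p I by (intro sum_mono mult_right_mono) (auto simp: simplex_on_def)
    finally show "Min (c ` I) \<le> (\<Sum>i\<in>I. c i * p i ^ 1)"
      by simp
  qed
qed

lemma minimum_on_simplex_power_le:
  fixes c :: "'i \<Rightarrow> real"
  assumes I: "finite I" "I \<noteq> {}" and c: "\<And>i. i \<in> I \<Longrightarrow> c i > 0" and e: "e > 1"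
  shows "minimum_on (simplex_on I) (\<lambda>p. \<Sum>i\<in>I. c i * p i ^ e)
      \<le> (\<Sum>i\<in>I. c i powr (- 1 / (real e - 1))) powr (1 - real e)"
proof -
  \<comment> \<open>The Lagrange condition makes \<open>c i * p i ^ (e - 1)\<close> independent of
    \<open>i\<close>, so \<open>p i\<close> is proportional to this \<open>w i\<close>; dividing by
    \<open>s\<close> normalizes.\<close>
  define w where "w = (\<lambda>i. c i powr (- 1 / (real e - 1)))"
  define s where "s = sum w I"
  have w: "w i > 0" if "i \<in> I" for i
    using c[OF that] by (simp add: w_def)
  then have s: "s > 0"
    unfolding s_def using I by (intro sum_pos) auto
  have "(\<lambda>i. w i / s) \<in> simplex_on I"
    using w s by (auto simp: simplex_on_def less_imp_le simp flip: sum_divide_distrib s_def)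
  then have "minimum_on (simplex_on I) (\<lambda>p. \<Sum>i\<in>I. c i * p i ^ e) \<le> (\<Sum>i\<in>I. c i * (w i / s) ^ e)"
    using minimum_on_simplex_le[OF I(1), of _ c "\<lambda>_. e"] by simp
  also have "\<dots> = (\<Sum>i\<in>I. w i / s ^ e)"
  proof (rule sum.cong[OF refl])
    fix i assume i: "i \<in> I"
    \<comment> \<open>By the choice of \<open>w\<close>, \<open>w i ^ (e - 1)\<close> is the inverse
      of \<open>c i\<close>, so one factor \<open>w i\<close> survives.\<close>
    have "c i * w i ^ e = c i powr 1 * c i powr (- 1 / (real e - 1) * real e)"
      using c[OF i] by (simp add: w_def powr_powr flip: powr_realpow)
    also have "\<dots> = c i powr (1 + - 1 / (real e - 1) * real e)"
      by (rule powr_add[symmetric])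
    also have "1 + - 1 / (real e - 1) * real e = - 1 / (real e - 1)"
      using e by (simp add: field_simps)
    finally have "c i * w i ^ e = w i"
      by (simp only: w_def)
    then show "c i * (w i / s) ^ e = w i / s ^ e"
      by (simp add: power_divide)
  qed
  also have "\<dots> = s / s ^ e"
    by (simp add: s_def sum_divide_distrib)
  also have "\<dots> = s powr (1 - real e)"
    using s by (simp add: powr_diff powr_realpow)
  finally show ?thesis
    by (simp only: s_def w_def)
qed

section \<open>Uniqueness of the order-preserving copy on a given vertex set\<close>

lemma card_less_inject:
  fixes a b :: "'b::linorder"
  assumes "finite S" "a \<in> S" "b \<in> S" "card {y \<in> S. y < a} = card {y \<in> S. y < b}"
  shows "a = b"
proof -
  have "card {y \<in> S. y < u} < card {y \<in> S. y < v}" if "u < v" "u \<in> S" for u v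
  proof (rule psubset_card_mono)
    show "finite {y \<in> S. y < v}"
      using assms(1) by simp
    have "{y \<in> S. y < u} \<subseteq> {y \<in> S. y < v}"
      using that(1) by (auto dest: less_trans)
    then show "{y \<in> S. y < u} \<subset> {y \<in> S. y < v}"
      using that by blast
  qed
  from this[of a b] this[of b a] show ?thesis
    using assms(2-4) by (cases a b rule: linorder_cases) auto
qed

text \<open>The right-hand side does not mention \<open>f\<close>: the rank of \<open>f x\<close> in
  the image is dictated by \<open>H\<close>. Since \<open>lt H\<close> is total and \<open>f\<close>
  is strictly increasing, exactly the predecessors of \<open>x\<close> land below
  \<open>f x\<close>.\<close>

lemma op_copy_rank:
  assumes H: "ordered_graph H" and f: "op_copy H (complete_ograph n) f" and x: "x \<in> verts H"
  shows "card {y \<in> f ` verts H. y < f x} = card {z \<in> verts H. (z, x) \<in> lt H}"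
proof -
  have lt: "f y < f z" if "(y, z) \<in> lt H" for y z
    using f that by (fastforce simp: op_copy_def complete_ograph_def)
  have tot: "(y, z) \<in> lt H \<or> (z, y) \<in> lt H" if "y \<in> verts H" "z \<in> verts H" "y \<noteq> z" for y z
    using H that by (auto simp: ordered_graph_def strict_linear_order_on_def total_on_def)
  have "{y \<in> f ` verts H. y < f x} = f ` {z \<in> verts H. (z, x) \<in> lt H}"
  proof (intro equalityI subsetI)
    fix y assume "y \<in> {y \<in> f ` verts H. y < f x}"
    then obtain z where z: "z \<in> verts H" "y = f z" "f z < f x"
      by blast
    then have "(z, x) \<in> lt H"
      using tot[OF z(1) x] lt[of x z] by auto
    then show "y \<in> f ` {z \<in> verts H. (z, x) \<in> lt H}"
      using z by blast
  qed (use lt in blast)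
  moreover have "inj_on f {z \<in> verts H. (z, x) \<in> lt H}"
    using f by (auto simp: op_copy_def inj_on_def)
  ultimately show ?thesis
    by (simp add: card_image)
qed

text \<open>Both values have the same rank in the common image, and a rank determines an
  element.\<close>

lemma op_copy_unique:
  assumes H: "ordered_graph H" and f: "op_copy H (complete_ograph n) f"
    and g: "op_copy H (complete_ograph n) g" and eq: "f ` verts H = g ` verts H"
    and x: "x \<in> verts H"
  shows "f x = g x"
proof (rule card_less_inject)
  show "finite (f ` verts H)"
    using H by (simp add: ordered_graph_def)
  show "f x \<in> f ` verts H" "g x \<in> f ` verts H"
    using x eq by auto
  show "card {y \<in> f ` verts H. y < f x} = card {y \<in> f ` verts H. y < g x}"
    using op_copy_rank[OF H f x] op_copy_rank[OF H g x] eq by simp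
qed

section \<open>Expectations under the random coloring, written as finite weighted sums\<close>

lemma sum_PiE_prod_weight:
  fixes p :: "'c \<Rightarrow> real"
  assumes "finite E" "finite A" "sum p A = 1" "c \<in> A" "F \<subseteq> E"
  shows "(\<Sum>\<phi>\<in>E \<rightarrow>\<^sub>E A. (\<Prod>e\<in>E. p (\<phi> e)) * of_bool (\<forall>e\<in>F. \<phi> e = c)) = p c ^ card F"
proof -
  \<comment> \<open>For \<open>e\<close> in \<open>F\<close>, \<open>q e\<close> keeps only the mass
    of color \<open>c\<close>. This spreads the indicator over the factors, so that distributivity
    turns the sum over colorings into a product of sums: \<open>p c\<close> on \<open>F\<close>, and
    total mass 1 elsewhere.\<close>
  define q where "q = (\<lambda>e j. if e \<in> F \<and> j \<noteq> c then 0 else p j)"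
  have "(\<Prod>e\<in>E. p (\<phi> e)) * of_bool (\<forall>e\<in>F. \<phi> e = c) = (\<Prod>e\<in>E. q e (\<phi> e))" for \<phi>
  proof (cases "\<forall>e\<in>F. \<phi> e = c")
    case True
    then show ?thesis
      by (simp add: q_def cong: if_cong) (rule prod.cong, auto)
  next
    case False
    then have "\<exists>e\<in>E. q e (\<phi> e) = 0"
      using assms(5) by (auto simp: q_def)
    then have "(\<Prod>e\<in>E. q e (\<phi> e)) = 0"
      using assms(1) by (intro prod_zero) auto
    with False show ?thesis
      by auto
  qed
  then have "(\<Sum>\<phi>\<in>E \<rightarrow>\<^sub>E A. (\<Prod>e\<in>E. p (\<phi> e)) * of_bool (\<forall>e\<in>F. \<phi> e = c))
      = (\<Prod>e\<in>E. \<Sum>j\<in>A. q e j)"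
    using assms by (simp add: prod_sum_PiE)
  also have "\<dots> = (\<Prod>e\<in>E. if e \<in> F then p c else 1)"
  proof (rule prod.cong[OF refl])
    fix e
    have "(\<Sum>j\<in>A. q e j) = (\<Sum>j\<in>A. if j = c then p c else 0)" if "e \<in> F"
      using that by (intro sum.cong) (auto simp: q_def)
    then show "(\<Sum>j\<in>A. q e j) = (if e \<in> F then p c else 1)"
      using assms by (simp add: q_def)
  qed
  also have "\<dots> = p c ^ card F"
    using assms(1,5) by (simp add: prod.If_cases Int_absorb1)
  finally show ?thesis .
qed

lemma finite_edges_complete_ograph: "finite (edges (complete_ograph n))"
  by (rule finite_subset[of _ "Pow {1..n}"]) (auto simp: complete_ograph_def)

text \<open>The probability of \<open>\<phi>\<close> when edges are colored independently with
  distribution \<open>p\<close>.\<close>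

definition coloring_weight :: "(nat \<Rightarrow> real) \<Rightarrow> nat \<Rightarrow> (nat set \<Rightarrow> nat) \<Rightarrow> real" where
  "coloring_weight p n \<phi> = (\<Prod>e\<in>edges (complete_ograph n). p (\<phi> e))"

lemma coloring_weight_nonneg:
  "p \<in> simplex_on {1..k} \<Longrightarrow> \<phi> \<in> colorings k n \<Longrightarrow> 0 \<le> coloring_weight p n \<phi>"
  unfolding coloring_weight_def
  by (intro prod_nonneg) (auto simp: simplex_on_def colorings_def dest!: PiE_mem)

lemma sum_coloring_weight_mono_on:
  assumes "p \<in> simplex_on {1..k}" "c \<in> {1..k}" "F \<subseteq> edges (complete_ograph n)"
  shows "(\<Sum>\<phi>\<in>colorings k n. coloring_weight p n \<phi> * of_bool (\<forall>e\<in>F. \<phi> e = c)) = p c ^ card F"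
  unfolding colorings_def coloring_weight_def
  using assms by (intro sum_PiE_prod_weight finite_edges_complete_ograph) (auto simp: simplex_on_def)

text \<open>The left-hand side is the probability that \<open>S\<close> carries a copy of color
  \<open>c\<close>. It is 0 if no order-preserving map has image \<open>S\<close>; otherwise the
  event forces the edges of one fixed copy to have color \<open>c\<close>.\<close>

lemma sum_coloring_weight_mono_copy:
  assumes H: "ordered_graph H" and p: "p \<in> simplex_on {1..k}" and c: "c \<in> {1..k}"
  shows "(\<Sum>\<phi>\<in>colorings k n. coloring_weight p n \<phi> * of_bool (S \<in> mono_copies n \<phi> c H))
      \<le> p c ^ num_edges H"
proof (cases "\<exists>f. op_copy H (complete_ograph n) f \<and> f ` verts H = S")
  case False
  then have "S \<notin> mono_copies n \<phi> c H" for \<phi>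
    by (auto simp: mono_copies_def)
  then show ?thesis
    using p c by (simp add: simplex_on_def)
next
  case True
  then obtain f where f: "op_copy H (complete_ograph n) f" "f ` verts H = S"
    by blast
  define F where "F = (`) f ` edges H"
  have sub: "e \<subseteq> verts H" if "e \<in> edges H" for e
    using H that by (auto simp: ordered_graph_def)
  \<comment> \<open>Injectivity on vertices keeps the images of distinct edges distinct, so the
    exponent is the full edge number of \<open>H\<close>.\<close>
  have "inj_on ((`) f) (edges H)"
    using f(1) sub by (intro inj_onI) (metis inj_on_image_eq_iff op_copy_def)
  then have card: "card F = num_edges H"
    by (simp add: F_def num_edges_def card_image)
  have F: "F \<subseteq> edges (complete_ograph n)"
    using f(1) by (auto simp: F_def op_copy_def)
  \<comment> \<open>Membership only supplies some map \<open>g\<close> with image \<open>S\<close>;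
    uniqueness identifies its edges with those of \<open>f\<close>.\<close>
  have "\<forall>e\<in>F. \<phi> e = c" if mono: "S \<in> mono_copies n \<phi> c H" for \<phi>
  proof -
    obtain g where g: "op_copy H (complete_ograph n) g" "g ` verts H = S"
      "\<forall>e\<in>edges H. \<phi> (g ` e) = c"
      using mono by (auto simp: mono_copies_def)
    have "f ` e = g ` e" if "e \<in> edges H" for e
      using op_copy_unique[OF H f(1) g(1)] f(2) g(2) sub[OF that] by (intro image_cong) auto
    then show ?thesis
      using g(3) by (auto simp: F_def)
  qed
  then have "(\<Sum>\<phi>\<in>colorings k n. coloring_weight p n \<phi> * of_bool (S \<in> mono_copies n \<phi> c H))
      \<le> (\<Sum>\<phi>\<in>colorings k n. coloring_weight p n \<phi> * of_bool (\<forall>e\<in>F. \<phi> e = c))"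
    using coloring_weight_nonneg[OF p] by (intro sum_mono mult_left_mono) auto
  also have "\<dots> = p c ^ num_edges H"
    using sum_coloring_weight_mono_on[OF p c F] card by simp
  finally show ?thesis .
qed

text \<open>Linearity of expectation: the count is a sum of indicators over all vertex sets of the
  right size.\<close>

lemma sum_coloring_weight_num_mono:
  assumes "ordered_graph H" "p \<in> simplex_on {1..k}" "c \<in> {1..k}"
  shows "(\<Sum>\<phi>\<in>colorings k n. coloring_weight p n \<phi> * real (num_mono n \<phi> c H))
      \<le> p c ^ num_edges H * real (n choose num_verts H)"
proof -
  define T where "T = {S. S \<subseteq> {1..n} \<and> card S = num_verts H}"
  have T: "finite T" "card T = n choose num_verts H"
    unfolding T_def using n_subsets[of "{1..n}"] by auto
  have "real (num_mono n \<phi> c H) = (\<Sum>S\<in>T. of_bool (S \<in> mono_copies n \<phi> c H))" for \<phi>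
  proof -
    have "T \<inter> {S. S \<in> mono_copies n \<phi> c H} = mono_copies n \<phi> c H"
      using mono_copies_sub[of n \<phi> c H] unfolding T_def by blast
    then show ?thesis
      using T(1) by (simp add: num_mono_eq of_bool_def sum.If_cases)
  qed
  then have "(\<Sum>\<phi>\<in>colorings k n. coloring_weight p n \<phi> * real (num_mono n \<phi> c H))
      = (\<Sum>S\<in>T. \<Sum>\<phi>\<in>colorings k n. coloring_weight p n \<phi> * of_bool (S \<in> mono_copies n \<phi> c H))"
    by (simp only: sum_distrib_left) (rule sum.swap)
  also have "\<dots> \<le> (\<Sum>S\<in>T. p c ^ num_edges H)"
    using assms by (intro sum_mono sum_coloring_weight_mono_copy)
  finally show ?thesis
    using T(2) by (simp add: mult.commute)
qed

section \<open>From expectations to bounds on the multiplicity function and its limit\<close>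

lemma multiplicity_fun_le_weighted:
  assumes p: "p \<in> simplex_on {1..k}"
    and G: "\<And>i. i \<in> {1..k} \<Longrightarrow> ordered_graph (G i)"
    and lam: "\<And>i. i \<in> {1..k} \<Longrightarrow> lam i \<ge> 0"
  shows "multiplicity_fun k lam n G
      \<le> (\<Sum>i\<in>{1..k}. lam i * p i ^ num_edges (G i) * real (n choose num_verts (G i)))"
proof -
  let ?w = "coloring_weight p n" and ?m = "multiplicity_fun k lam n G"
  \<comment> \<open>For \<open>k = 0\<close> the sum of \<open>p\<close> would be empty, hence 0
    rather than 1.\<close>
  have "k \<ge> 1"
    using p by (cases k) (auto simp: simplex_on_def)
  \<comment> \<open>The empty edge set imposes no condition, so its probability is the total
    weight.\<close>
  then have "(\<Sum>\<phi>\<in>colorings k n. ?w \<phi>) = 1"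
    using sum_coloring_weight_mono_on[OF p, of 1 "{}" n] by simp
  then have "?m = (\<Sum>\<phi>\<in>colorings k n. ?w \<phi> * ?m)"
    by (simp flip: sum_distrib_right)
  \<comment> \<open>The minimum over colorings is at most each value, hence at most the weighted
    average.\<close>
  also have "\<dots> \<le> (\<Sum>\<phi>\<in>colorings k n. ?w \<phi> * (\<Sum>i\<in>{1..k}. lam i * real (num_mono n \<phi> i (G i))))"
    by (intro sum_mono mult_left_mono multiplicity_fun_le coloring_weight_nonneg[OF p])
  also have "\<dots> = (\<Sum>i\<in>{1..k}. lam i * (\<Sum>\<phi>\<in>colorings k n. ?w \<phi> * real (num_mono n \<phi> i (G i))))"
    by (simp only: sum_distrib_left mult.left_commute) (rule sum.swap)
  also have "\<dots> \<le> (\<Sum>i\<in>{1..k}. lam i * (p i ^ num_edges (G i) * real (n choose num_verts (G i))))"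
    using p G lam by (intro sum_mono mult_left_mono sum_coloring_weight_num_mono) auto
  finally show ?thesis
    by (simp only: mult.assoc)
qed

text \<open>An infinite set has \<open>card\<close> 0, so nonemptiness alone does not suffice; the
  edges form a finite set because they lie in the power set of the finite vertex set.\<close>

lemma num_edges_pos: "ordered_graph H \<Longrightarrow> edges H \<noteq> {} \<Longrightarrow> num_edges H > 0"
  unfolding num_edges_def ordered_graph_def
  by (metis PowI card_gt_0_iff finite_Pow_iff finite_subset subsetI)

lemma multiplicity_const_le_weighted:
  fixes k :: nat and G :: "nat \<Rightarrow> 'a ograph"
  defines "I \<equiv> min_order_indices k G"
  assumes k: "k \<ge> 1" and G: "\<And>i. i \<in> {1..k} \<Longrightarrow> ordered_graph (G i)"
    and edge: "\<And>i. i \<in> {1..k} \<Longrightarrow> edges (G i) \<noteq> {}"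
    and lam: "\<And>i. i \<in> {1..k} \<Longrightarrow> lam i > 0"
    and p: "p \<in> simplex_on I"
  shows "multiplicity_const k lam G \<le> (\<Sum>i\<in>I. lam i * p i ^ num_edges (G i))"
proof -
  define h where "h = min_order k G"
  define q where "q = (\<lambda>i. if i \<in> I then p i else 0)"
  define s where "s = (\<Sum>i\<in>I. lam i * p i ^ num_edges (G i))"
  have I: "I \<subseteq> {1..k}" and h: "\<And>i. i \<in> I \<Longrightarrow> num_verts (G i) = h"
    by (auto simp: I_def h_def min_order_indices_def)
  have "sum q {1..k} = sum q I"
    using I by (intro sum.mono_neutral_right) (auto simp: q_def)
  also have "\<dots> = sum p I"
    by (auto simp: q_def)
  finally have q: "q \<in> simplex_on {1..k}"
    using p by (auto simp: simplex_on_def q_def)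
  have M: "multiplicity_fun k lam n G \<le> s * real (n choose h)" for n
  proof -
    have "multiplicity_fun k lam n G
        \<le> (\<Sum>i\<in>{1..k}. lam i * q i ^ num_edges (G i) * real (n choose num_verts (G i)))"
      using G lam by (intro multiplicity_fun_le_weighted[OF q]) (auto intro: less_imp_le)
    also have "\<dots> = (\<Sum>i\<in>I. lam i * q i ^ num_edges (G i) * real (n choose num_verts (G i)))"
    proof (rule sum.mono_neutral_right)
      show "\<forall>i\<in>{1..k} - I. lam i * q i ^ num_edges (G i) * real (n choose num_verts (G i)) = 0"
      proof
        fix i assume i: "i \<in> {1..k} - I"
        \<comment> \<open>As \<open>0 ^ 0 = 1\<close>, the zero extension kills this term only
          because the exponent is positive.\<close>
        then have "num_edges (G i) > 0"
          using G edge by (intro num_edges_pos) auto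
        then show "lam i * q i ^ num_edges (G i) * real (n choose num_verts (G i)) = 0"
          using i by (simp add: q_def)
      qed
    qed (use I in auto)
    also have "\<dots> = s * real (n choose h)"
      unfolding s_def sum_distrib_right by (intro sum.cong) (auto simp: q_def h)
    finally show ?thesis .
  qed
  \<comment> \<open>For \<open>n < h\<close> the binomial is 0 and the bound cannot be divided by
    it; the limit only sees large \<open>n\<close>.\<close>
  have "multiplicity_fun k lam n G / real (n choose h) \<le> s" if "n \<ge> h" for n
    using M[of n] that by (simp add: divide_le_eq zero_less_binomial)
  moreover have "(\<lambda>n. multiplicity_fun k lam n G / real (n choose h)) \<longlonglongrightarrow> multiplicity_const k lam G"
    unfolding h_def by (intro multiplicity_const_tendsto k lam edge)
  ultimately show ?thesis
    unfolding s_def by (blast intro: LIMSEQ_le_const2)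
qed

theorem theorem2p4:
  fixes k :: nat and G :: "nat \<Rightarrow> 'a ograph" and lam :: "nat \<Rightarrow> real"
  assumes "k \<ge> 1"
    and "\<And>i. i \<in> {1..k} \<Longrightarrow> ordered_graph (G i)"
    and "\<And>i. i \<in> {1..k} \<Longrightarrow> edges (G i) \<noteq> {}"
    and "\<And>i. i \<in> {1..k} \<Longrightarrow> lam i > 0"
  defines "I \<equiv> min_order_indices k G"
  shows "(\<forall>n::nat. multiplicity_fun k lam n G
            \<le> minimum_on (simplex_on {1..k})
                (\<lambda>p. \<Sum>i\<in>{1..k}. lam i * p i ^ num_edges (G i) * real (n choose num_verts (G i))))
       \<and> multiplicity_const k lam G
            \<le> minimum_on (simplex_on I) (\<lambda>p. \<Sum>i\<in>I. lam i * p i ^ num_edges (G i))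
       \<and> (\<forall>e::nat. e > 1 \<and> (\<forall>i\<in>I. num_edges (G i) = e) \<longrightarrow>
            multiplicity_const k lam G
              \<le> (\<Sum>i\<in>I. lam i powr (- 1 / (real e - 1))) powr (1 - real e))
       \<and> ((\<forall>i\<in>I. num_edges (G i) = 1) \<longrightarrow>
            minimum_on (simplex_on I) (\<lambda>p. \<Sum>i\<in>I. lam i * p i ^ num_edges (G i)) = Min (lam ` I))"
proof -
  note k = assms(1) and G = assms(2) and edge = assms(3) and lam = assms(4)
  let ?F = "\<lambda>p. \<Sum>i\<in>I. lam i * p i ^ num_edges (G i)"
  have "min_order k G \<in> (\<lambda>i. num_verts (G i)) ` {1..k}"
    unfolding min_order_def using k by (intro Min_in) auto
  then have I: "finite I" "I \<noteq> {}" "I \<subseteq> {1..k}"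
    by (auto simp: I_def min_order_indices_def)
  have "multiplicity_fun k lam n G
      \<le> minimum_on (simplex_on {1..k})
          (\<lambda>p. \<Sum>i\<in>{1..k}. lam i * p i ^ num_edges (G i) * real (n choose num_verts (G i)))" for n
  proof -
    \<comment> \<open>The binomial is absorbed into the coefficient to reach the form
      \<open>c i * p i ^ d i\<close> of the simplex lemmas.\<close>
    have "multiplicity_fun k lam n G
      \<le> minimum_on (simplex_on {1..k})
          (\<lambda>p. \<Sum>i\<in>{1..k}. (lam i * real (n choose num_verts (G i))) * p i ^ num_edges (G i))"
    proof (rule minimum_on_simplex_greatest)
      fix p assume "p \<in> simplex_on {1..k}"
      then show "multiplicity_fun k lam n G
          \<le> (\<Sum>i\<in>{1..k}. (lam i * real (n choose num_verts (G i))) * p i ^ num_edges (G i))"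
        using multiplicity_fun_le_weighted[of p k G lam n] G lam
        by (simp add: less_imp_le mult_ac)
    qed (use k in auto)
    then show ?thesis
      by (simp only: mult_ac)
  qed
  moreover have const: "multiplicity_const k lam G \<le> minimum_on (simplex_on I) ?F"
  proof (rule minimum_on_simplex_greatest[OF I(1,2)])
    fix p assume p: "p \<in> simplex_on I"
    show "multiplicity_const k lam G \<le> ?F p"
      by (intro multiplicity_const_le_weighted[of k G lam p, folded I_def] k G edge lam p)
  qed
  moreover have "multiplicity_const k lam G
      \<le> (\<Sum>i\<in>I. lam i powr (- 1 / (real e - 1))) powr (1 - real e)"
    if e: "e > 1" "\<forall>i\<in>I. num_edges (G i) = e" for e
  proof -
    have "?F = (\<lambda>p. \<Sum>i\<in>I. lam i * p i ^ e)"
      using e(2) by (intro ext sum.cong) auto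
    then have "multiplicity_const k lam G
        \<le> minimum_on (simplex_on I) (\<lambda>p. \<Sum>i\<in>I. lam i * p i ^ e)"
      using const by (simp only:)
    also have "\<dots> \<le> (\<Sum>i\<in>I. lam i powr (- 1 / (real e - 1))) powr (1 - real e)"
      using lam I by (intro minimum_on_simplex_power_le e(1)) auto
    finally show ?thesis .
  qed
  moreover have "minimum_on (simplex_on I) ?F = Min (lam ` I)" if "\<forall>i\<in>I. num_edges (G i) = 1"
  proof -
    have "?F = (\<lambda>p. \<Sum>i\<in>I. lam i * p i ^ 1)"
      using that by (intro ext sum.cong) auto
    then show ?thesis
      using minimum_on_simplex_linear[OF I(1,2), of lam] by (simp only:)
  qed
  ultimately show ?thesis
    by blast
qed

end
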